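(* Let $\beta>0$, $w(t)=1+\exp(-\beta t)$ for $t\in\mathbb R$, and let $\mathcal L$ denote the weighted two-sided Laplace transform on $[0,\beta]$, extended to nonnegative measures of finite $w$-weighted mass. Let $\mu>0$ and define the family of Dirac measures $$\mathcal F=\{\delta_t : t\in[-\mu,\mu]\}.$$ Then the forward-backward amplification of $\mathcal L$ on $\mathcal F$ is $$a_w(\mathcal F)=\frac{\beta\mu/2}{\tanh(\beta\mu/2)}.$$
   Context: The two-sided Laplace transform is the operator $\mathcal L:L^1(\mathbb R,w(t)\,dt)\to L^1([0,\beta],ds)$, $\mathcal L[f](s)=\int_{-\infty}^\infty\exp(-st)f(t)\,dt$ for $s\in[0,\beta]$. Let $M_w^+(\mathbb R)$ be the set of nonnegative measures $\nu$ on $\mathbb R$ with $\|\nu\|_{M_w^+(\mathbb R)}:=\int_{\mathbb R}w(t)\,d\nu(t)<\infty$. $\mathcal L$ is extended to $\nu\in M_w^+(\mathbb R)$ by $\mathcal L[\nu](s)=\int_{\mathbb R}\exp(-st)\,d\nu(t)$, $s\in[0,\beta]$. For a family $\mathcal F\subset M_w^+(\mathbb R)$ of nonzero measures, the forward-backward amplification on $\mathcal F$ is $$a_w(\mathcal F)=\sup_{\nu\in\mathcal F\setminus\{0\}}\frac{\|\mathcal L[\nu]\|_{L^1(0,\beta)}}{\|\nu\|_{M_w^+(\mathbb R)}}\;\cdot\;\sup_{\gamma\in\mathcal L(\mathcal F)\setminus\{0\}}\frac{\|\mathcal L^{-1}[\gamma]\|_{M_w^+(\mathbb R)}}{\|\gamma\|_{L^1(0,\beta)}},$$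 where for $\gamma\in\mathcal L(\mathcal F)$, $\mathcal L^{-1}[\gamma]$ is the measure $\nu\in\mathcal F$ with $\mathcal L[\nu]=\gamma$. Equivalently, with $R_w(\nu)=\|\mathcal L[\nu]\|_{L^1(0,\beta)}/\|\nu\|_{M_w^+(\mathbb R)}$, $a_w(\mathcal F)=\sup_{\nu\in\mathcal F}R_w(\nu)\,/\,\inf_{\nu\in\mathcal F}R_w(\nu)$. $\delta_t$ is the Dirac measure at $t$. *)

theory Defs
  imports "HOL-Probability.Probability"
begin

text \<open>Norms take values in the extended nonnegative reals, so that they, and the suprema of their
  quotients, are defined without side conditions. Nonnegative measures on the real line are Borel
  measures.\<close>

definition weighted_norm :: "(real \<Rightarrow> real) \<Rightarrow> real measure \<Rightarrow> ennreal" where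
  "weighted_norm w \<nu> = (\<integral>\<^sup>+ t. ennreal (w t) \<partial>\<nu>)"

definition weighted_measures :: "(real \<Rightarrow> real) \<Rightarrow> real measure set" where
  "weighted_measures w = {\<nu>. sets \<nu> = sets borel \<and> weighted_norm w \<nu> < \<infinity>}"

definition laplace :: "real \<Rightarrow> real measure \<Rightarrow> real \<Rightarrow> real" where
  "laplace \<beta> \<nu> = (\<lambda>s\<in>{0..\<beta>}. LINT t|\<nu>. exp (- s * t))"

text \<open>Elements of the space of integrable functions on the interval from 0 to \<open>\<beta>\<close> are represented
  by functions; equality there is equality almost everywhere on that interval.\<close>

definition L1_eq :: "real \<Rightarrow> (real \<Rightarrow> real) \<Rightarrow> (real \<Rightarrow> real) \<Rightarrow> bool" where
  "L1_eq \<beta> \<gamma> \<gamma>' \<longleftrightarrow> (AE s in lborel. s \<in> {0..\<beta>} \<longrightarrow> \<gamma> s = \<gamma>' s)"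

definition L1_norm :: "real \<Rightarrow> (real \<Rightarrow> real) \<Rightarrow> ennreal" where
  "L1_norm \<beta> \<gamma> = (\<integral>\<^sup>+ s\<in>{0..\<beta>}. ennreal \<bar>\<gamma> s\<bar> \<partial>lborel)"

text \<open>The inverse is meaningful only when the transform is injective on \<open>F\<close>, up to equality almost
  everywhere.\<close>

definition laplace_inv :: "real \<Rightarrow> real measure set \<Rightarrow> (real \<Rightarrow> real) \<Rightarrow> real measure" where
  "laplace_inv \<beta> F \<gamma> = (THE \<nu>. \<nu> \<in> F \<and> L1_eq \<beta> (laplace \<beta> \<nu>) \<gamma>)"

text \<open>Intended for \<open>F \<subseteq> weighted_measures w\<close>; the zero measure is \<open>null_measure borel\<close>.\<close>

definition amplification :: "(real \<Rightarrow> real) \<Rightarrow> real \<Rightarrow> real measure set \<Rightarrow> ennreal" where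
  "amplification w \<beta> F =
     (SUP \<nu>\<in>F - {null_measure borel}. L1_norm \<beta> (laplace \<beta> \<nu>) / weighted_norm w \<nu>) *
     (SUP \<gamma>\<in>{\<gamma> \<in> laplace \<beta> ` F. \<not> L1_eq \<beta> \<gamma> (\<lambda>_. 0)}.
        weighted_norm w (laplace_inv \<beta> F \<gamma>) / L1_norm \<beta> \<gamma>)"

definition dirac_family :: "real \<Rightarrow> real measure set" where
  "dirac_family \<mu> = {return borel t | t. t \<in> {-\<mu>..\<mu>}}"

lemma dirac_family_subset:
  assumes "w \<in> borel_measurable borel"
  shows "dirac_family \<mu> \<subseteq> weighted_measures w"
  using assms
  by (auto simp: dirac_family_def weighted_measures_def weighted_norm_def nn_integral_return)

lemma laplace_return:
  assumes "s \<in> {0..\<beta>}"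
  shows "laplace \<beta> (return borel t) s = exp (- s * t)"
  using assms by (simp add: laplace_def integral_return)

lemma laplace_inv_dirac:
  assumes "\<beta> > 0" "t \<in> {-\<mu>..\<mu>}"
  shows "laplace_inv \<beta> (dirac_family \<mu>) (laplace \<beta> (return borel t)) = return borel t"
  unfolding laplace_inv_def
proof (rule the_equality)
  show "return borel t \<in> dirac_family \<mu> \<and>
      L1_eq \<beta> (laplace \<beta> (return borel t)) (laplace \<beta> (return borel t))"
    using assms by (auto simp: dirac_family_def L1_eq_def)
next
  fix \<nu>
  assume \<nu>: "\<nu> \<in> dirac_family \<mu> \<and> L1_eq \<beta> (laplace \<beta> \<nu>) (laplace \<beta> (return borel t))"
  then obtain u where u: "\<nu> = return borel u"
    by (auto simp: dirac_family_def)
  have "\<exists>s\<in>{0<..\<beta>}. laplace \<beta> \<nu> s = laplace \<beta> (return borel t) s"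
  proof (rule ccontr)
    assume "\<not> ?thesis"
    with \<nu> have "AE s in lborel. s \<notin> {0<..\<beta>}"
      unfolding L1_eq_def by (auto elim!: eventually_mono)
    then have "emeasure lborel {0<..\<beta>} = 0"
      by (subst (asm) AE_iff_measurable[OF _ refl]) (auto simp: greaterThanAtMost_def greaterThan_def atMost_def Int_def)
    with assms show False by simp
  qed
  then show "\<nu> = return borel t"
    unfolding u by (auto simp: laplace_return)
qed

end

theory Submission imports Defs begin

text \<open>On Dirac measures the quotient of the two norms is \<open>tanh (\<beta> t / 2) / t\<close>, with value
  \<open>\<beta> / 2\<close> at \<open>t = 0\<close>. This is an even function which decreases in \<open>\<bar>t\<bar>\<close>, so its supremum
  is attained at \<open>0\<close> and its infimum at \<open>\<plusminus>\<mu>\<close>.\<close>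

text \<open>The difference \<open>tanh x - x\<close> vanishes at 0 and has derivative
  \<open>- (tanh x)^2\<close>. The bound serves to compare the quotient at nonzero points with its
  value at 0.\<close>

lemma tanh_le_self:
  fixes x :: real
  assumes "0 \<le> x"
  shows "tanh x \<le> x"
proof -
  have "tanh 0 - 0 \<ge> tanh x - x"
  proof (rule DERIV_nonpos_imp_nonincreasing[OF assms])
    fix y :: real
    have "((\<lambda>x. tanh x - x) has_real_derivative (1 - tanh y ^ 2) - 1) (at y)"
      by (auto intro!: derivative_eq_intros)
    then show "\<exists>d. ((\<lambda>x. tanh x - x) has_real_derivative d) (at y) \<and> d \<le> 0"
      by (intro exI conjI) auto
  qed
  then show ?thesis by simp
qed

text \<open>The right side minus the left vanishes at 0 and has derivative
  \<open>2 * y * tanh y * (1 - tanh y ^ 2)\<close>, which is nonnegative for \<open>y\<close> \<ge>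
  0. This fixes the sign of the numerator in the derivative of \<open>tanh x / x\<close>.\<close>

lemma self_mult_tanh_deriv_le:
  fixes x :: real
  assumes "0 \<le> x"
  shows "x * (1 - tanh x ^ 2) \<le> tanh x"
proof -
  have "tanh 0 - 0 * (1 - tanh 0 ^ 2) \<le> tanh x - x * (1 - tanh x ^ 2)"
  proof (rule DERIV_nonneg_imp_nondecreasing[OF assms])
    fix y :: real
    assume "0 \<le> y"
    have "((\<lambda>x. tanh x - x * (1 - tanh x ^ 2)) has_real_derivative
        2 * y * tanh y * (1 - tanh y ^ 2)) (at y)"
      by (auto intro!: derivative_eq_intros simp: algebra_simps power2_eq_square)
    moreover have "0 \<le> 2 * y * tanh y * (1 - tanh y ^ 2)"
      using \<open>0 \<le> y\<close> tanh_real_bounds[of y] by (auto intro!: mult_nonneg_nonneg simp: abs_square_le_1)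
    ultimately show "\<exists>d. ((\<lambda>x. tanh x - x * (1 - tanh x ^ 2)) has_real_derivative d) (at y) \<and> 0 \<le> d"
      by blast
  qed
  then show ?thesis by simp
qed

lemma tanh_over_self_antimono:
  fixes x y :: real
  assumes "0 < x" "x \<le> y"
  shows "tanh y / y \<le> tanh x / x"
proof (rule DERIV_nonpos_imp_nonincreasing[OF assms(2)])
  fix z :: real
  assume "x \<le> z"
  then have z: "0 < z" using assms(1) by simp
  have "((\<lambda>x. tanh x / x) has_real_derivative (z * (1 - tanh z ^ 2) - tanh z) / z ^ 2) (at z)"
    using z by (auto intro!: derivative_eq_intros simp: field_simps power2_eq_square)
  moreover have "(z * (1 - tanh z ^ 2) - tanh z) / z ^ 2 \<le> 0"
    using self_mult_tanh_deriv_le[of z] z by (simp add: divide_nonpos_pos)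
  ultimately show "\<exists>d. ((\<lambda>x. tanh x / x) has_real_derivative d) (at z) \<and> d \<le> 0"
    by blast
qed

text \<open>At \<open>x = \<beta> * t\<close> the second factor on the right is exactly the weight,
  so it cancels from the quotient of the norms and leaves only the even \<open>tanh\<close>
  term.\<close>

lemma one_minus_exp_eq_tanh:
  fixes x :: real
  shows "1 - exp (- x) = tanh (x / 2) * (1 + exp (- x))"
  by (simp add: tanh_real_altdef add_pos_pos less_imp_neq[symmetric])

lemma L1_norm_laplace_return:
  assumes "\<beta> > 0"
  shows "L1_norm \<beta> (laplace \<beta> (return borel t)) =
    ennreal (if t = 0 then \<beta> else (1 - exp (- \<beta> * t)) / t)"
proof -
  \<comment> \<open>An antiderivative in \<open>s\<close> of \<open>exp (- s * t)\<close>; at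
    \<open>t = 0\<close> the integrand is constantly 1.\<close>
  define G where "G = (\<lambda>s. if t = 0 then s else - exp (- s * t) / t)"
  have "L1_norm \<beta> (laplace \<beta> (return borel t)) =
      (\<integral>\<^sup>+ s. ennreal (exp (- s * t)) * indicator {0..\<beta>} s \<partial>lborel)"
    unfolding L1_norm_def
    by (intro nn_integral_cong) (auto simp: laplace_return split: split_indicator)
  also have "\<dots> = ennreal (G \<beta> - G 0)"
  proof (rule nn_integral_FTC_Icc)
    fix s
    show "(G has_real_derivative exp (- s * t)) (at s)"
      unfolding G_def by (cases "t = 0") (auto intro!: derivative_eq_intros)
  qed (use assms in auto)
  also have "G \<beta> - G 0 = (if t = 0 then \<beta> else (1 - exp (- \<beta> * t)) / t)"
    by (simp add: G_def field_simps)
  finally show ?thesis .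
qed

text \<open>The value at 0 is the limit of the other branch, where division by zero would give
  0.\<close>

definition dirac_quotient :: "real \<Rightarrow> real \<Rightarrow> real" where
  "dirac_quotient \<beta> t = (if t = 0 then \<beta> / 2 else tanh (\<beta> * t / 2) / t)"

lemma dirac_quotient_abs: "dirac_quotient \<beta> \<bar>t\<bar> = dirac_quotient \<beta> t"
  by (auto simp: dirac_quotient_def abs_if)

lemma dirac_quotient_antimono:
  assumes "\<beta> > 0" "\<bar>t\<bar> \<le> \<bar>u\<bar>"
  shows "dirac_quotient \<beta> u \<le> dirac_quotient \<beta> t"
proof -
  \<comment> \<open>By evenness only absolute values matter. If \<open>u = 0\<close> then also
    \<open>t = 0\<close>; the last case reduces to \<open>tanh x / x\<close> by the substitution
    \<open>x = \<beta> * \<bar>t\<bar> / 2\<close>.\<close>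
  consider "u = 0" | "t = 0" "u \<noteq> 0" | "t \<noteq> 0" "u \<noteq> 0" by blast
  then have "dirac_quotient \<beta> \<bar>u\<bar> \<le> dirac_quotient \<beta> \<bar>t\<bar>"
  proof cases
    case 2
    then show ?thesis
      using tanh_le_self[of "\<beta> * \<bar>u\<bar> / 2"] assms
      by (simp add: dirac_quotient_def field_simps)
  next
    case 3
    then show ?thesis
      using tanh_over_self_antimono[of "\<beta> * \<bar>t\<bar> / 2" "\<beta> * \<bar>u\<bar> / 2"] assms
      by (simp add: dirac_quotient_def field_simps)
  qed (use assms in simp)
  then show ?thesis by (simp only: dirac_quotient_abs)
qed

lemma dirac_quotient_pos:
  assumes "\<beta> > 0"
  shows "dirac_quotient \<beta> t > 0"
proof -
  have "dirac_quotient \<beta> \<bar>t\<bar> > 0"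
    using assms by (auto simp: dirac_quotient_def)
  then show ?thesis by (simp only: dirac_quotient_abs)
qed

lemma L1_norm_laplace_return_eq_quotient:
  assumes "\<beta> > 0"
  shows "L1_norm \<beta> (laplace \<beta> (return borel t)) =
    ennreal (dirac_quotient \<beta> t * (1 + exp (- \<beta> * t)))"
  using one_minus_exp_eq_tanh[of "\<beta> * t"]
  by (simp add: L1_norm_laplace_return[OF assms] dirac_quotient_def)

text \<open>Used in contrapositive form: a function with nonzero norm is not in the zero
  class.\<close>

lemma L1_norm_eq_0: "L1_eq \<beta> \<gamma> (\<lambda>_. 0) \<Longrightarrow> L1_norm \<beta> \<gamma> = 0"
  unfolding L1_eq_def L1_norm_def
  by (subst nn_integral_cong_AE[where v = "\<lambda>_. 0"])
    (auto elim!: eventually_mono split: split_indicator)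

theorem proposition2p4:
  fixes \<beta> \<mu> :: real and w :: "real \<Rightarrow> real"
  assumes "\<beta> > 0"
    and "\<And>t. w t = 1 + exp (- \<beta> * t)"
    and "\<mu> > 0"
  shows "amplification w \<beta> (dirac_family \<mu>) =
           ennreal ((\<beta> * \<mu> / 2) / tanh (\<beta> * \<mu> / 2))"
proof -
  let ?T = "{-\<mu>..\<mu>}"
  let ?R = "dirac_quotient \<beta>"
  let ?L = "\<lambda>t. laplace \<beta> (return borel t)"
  have w_pos: "w t > 0" for t
    by (simp add: assms(2) add_pos_pos)
  have [measurable]: "w \<in> borel_measurable borel"
    unfolding assms(2)[abs_def] by measurable
  have R_pos: "?R t > 0" for t
    using assms(1) by (rule dirac_quotient_pos)
  have wn: "weighted_norm w (return borel t) = ennreal (w t)" for t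
    by (simp add: weighted_norm_def nn_integral_return)
  have ln: "L1_norm \<beta> (?L t) = ennreal (?R t * w t)" for t
    unfolding assms(2) by (rule L1_norm_laplace_return_eq_quotient[OF assms(1)])
  have F: "dirac_family \<mu> = return borel ` ?T"
    by (auto simp: dirac_family_def)
  have nonzero: "return borel t \<noteq> null_measure borel" for t :: real
  proof
    assume "return borel t = null_measure borel"
    then have "emeasure (return borel t) UNIV = emeasure (null_measure borel) (UNIV :: real set)"
      by simp
    then show False by simp
  qed
  have "(SUP \<nu>\<in>dirac_family \<mu> - {null_measure borel}. L1_norm \<beta> (laplace \<beta> \<nu>) / weighted_norm w \<nu>)
      = (SUP t\<in>?T. ennreal (?R t))"
  proof -
    have "dirac_family \<mu> - {null_measure borel} = return borel ` ?T"
      using nonzero by (auto simp: F)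
    moreover have "L1_norm \<beta> (?L t) / weighted_norm w (return borel t) = ennreal (?R t)" for t
      using w_pos[of t] R_pos[of t] by (simp add: wn ln divide_ennreal)
    ultimately show ?thesis
      by (simp add: image_image)
  qed
  also have "\<dots> = ennreal (?R 0)"
  proof (rule antisym)
    show "(SUP t\<in>?T. ennreal (?R t)) \<le> ennreal (?R 0)"
      using assms(1) by (intro SUP_least ennreal_leI dirac_quotient_antimono) auto
    show "ennreal (?R 0) \<le> (SUP t\<in>?T. ennreal (?R t))"
      using assms(3) by (intro SUP_upper) auto
  qed
  finally have forward: "(SUP \<nu>\<in>dirac_family \<mu> - {null_measure borel}.
      L1_norm \<beta> (laplace \<beta> \<nu>) / weighted_norm w \<nu>) = ennreal (?R 0)" .
  have "(SUP \<gamma>\<in>{\<gamma> \<in> laplace \<beta> ` dirac_family \<mu>. \<not> L1_eq \<beta> \<gamma> (\<lambda>_. 0)}.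
      weighted_norm w (laplace_inv \<beta> (dirac_family \<mu>) \<gamma>) / L1_norm \<beta> \<gamma>)
      = (SUP t\<in>?T. ennreal (1 / ?R t))"
  proof -
    \<comment> \<open>No Dirac measure is mapped to the zero class, so the second supremum runs over
      all of \<open>?T\<close>; injectivity on the family then turns each term into the reciprocal
      of the forward quotient.\<close>
    have "L1_norm \<beta> (?L t) \<noteq> 0" for t
      using w_pos[of t] R_pos[of t] by (simp add: ln)
    then have "{\<gamma> \<in> laplace \<beta> ` dirac_family \<mu>. \<not> L1_eq \<beta> \<gamma> (\<lambda>_. 0)} = ?L ` ?T"
      using L1_norm_eq_0 by (auto simp: F)
    moreover have "weighted_norm w (laplace_inv \<beta> (dirac_family \<mu>) (?L t)) / L1_norm \<beta> (?L t)
        = ennreal (1 / ?R t)" if "t \<in> ?T" for t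
      using w_pos[of t] R_pos[of t]
      by (simp add: laplace_inv_dirac[OF assms(1) that] wn ln divide_ennreal)
    ultimately show ?thesis
      by (simp add: image_image)
  qed
  \<comment> \<open>The reciprocal is largest where \<open>?R\<close> is smallest, at the endpoint
    \<open>\<mu>\<close>, since \<bar>t\<bar> \<le> \<mu> on \<open>?T\<close>.\<close>
  also have "\<dots> = ennreal (1 / ?R \<mu>)"
  proof (rule antisym)
    show "(SUP t\<in>?T. ennreal (1 / ?R t)) \<le> ennreal (1 / ?R \<mu>)"
      using assms(1) R_pos
      by (intro SUP_least ennreal_leI divide_left_mono dirac_quotient_antimono) auto
    show "ennreal (1 / ?R \<mu>) \<le> (SUP t\<in>?T. ennreal (1 / ?R t))"
      using assms(3) by (intro SUP_upper) auto
  qed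
  finally have backward: "(SUP \<gamma>\<in>{\<gamma> \<in> laplace \<beta> ` dirac_family \<mu>. \<not> L1_eq \<beta> \<gamma> (\<lambda>_. 0)}.
      weighted_norm w (laplace_inv \<beta> (dirac_family \<mu>) \<gamma>) / L1_norm \<beta> \<gamma>) = ennreal (1 / ?R \<mu>)" .
  have "amplification w \<beta> (dirac_family \<mu>) = ennreal (?R 0 * (1 / ?R \<mu>))"
    unfolding amplification_def forward backward
    using R_pos[of 0] R_pos[of \<mu>] by (subst ennreal_mult) auto
  \<comment> \<open>Here \<open>?R 0\<close> is \<open>\<beta> / 2\<close>, while
    \<open>\<mu>\<close> \<noteq> 0 selects the \<open>tanh\<close> branch for
    \<open>?R \<mu>\<close>.\<close>
  also have "?R 0 * (1 / ?R \<mu>) = (\<beta> * \<mu> / 2) / tanh (\<beta> * \<mu> / 2)"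
    using assms(3) by (simp add: dirac_quotient_def)
  finally show ?thesis .
qed

end
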